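(* For $n\geq 1$ let $\mu(n)$ denote the degree of the variant $\mathcal T_n^a$ where $a\in\mathcal T_n$ has rank $1$. Then $\mu(1)<\mu(2)<\mu(3)<\cdots$.
   Context: $\mathcal T_n$ is the full transformation semigroup on $\{1,\dots,n\}$; the rank of a transformation is the size of its image. The variant $\mathcal T_n^a$ is the set $\mathcal T_n$ with operation $f\star g=fag$. The degree of a finite semigroup $S$ is the least $m\geq1$ such that $S$ embeds in $\mathcal T_m$. The degree of $\mathcal T_n^a$ does not depend on the choice of the rank-$1$ map $a$. *)

theory Defs
  imports "HOL-Library.FuncSet"
begin

definition full_trans :: "nat \<Rightarrow> (nat \<Rightarrow> nat) set" where
  "full_trans n = {1..n} \<rightarrow>\<^sub>E {1..n}"

text \<open>Maps act on the right: the product \<open>fg\<close> is ``first \<open>f\<close>, then \<open>g\<close>''.  The opposite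
  convention replaces both \<open>T\<^sub>m\<close> and the variants \<open>T\<^sub>n\<^sup>a\<close> by their duals, so the degree below
  is the same under either convention.\<close>

definition trans_mult :: "nat \<Rightarrow> (nat \<Rightarrow> nat) \<Rightarrow> (nat \<Rightarrow> nat) \<Rightarrow> nat \<Rightarrow> nat" where
  "trans_mult n f g = compose {1..n} g f"

definition trans_rank :: "nat \<Rightarrow> (nat \<Rightarrow> nat) \<Rightarrow> nat" where
  "trans_rank n f = card (f ` {1..n})"

definition variant_mult ::
    "nat \<Rightarrow> (nat \<Rightarrow> nat) \<Rightarrow> (nat \<Rightarrow> nat) \<Rightarrow> (nat \<Rightarrow> nat) \<Rightarrow> nat \<Rightarrow> nat" where
  "variant_mult n a f g = trans_mult n (trans_mult n f a) g"

definition embeds_in_full_trans :: "'a set \<Rightarrow> ('a \<Rightarrow> 'a \<Rightarrow> 'a) \<Rightarrow> nat \<Rightarrow> bool" where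
  "embeds_in_full_trans S mult m \<longleftrightarrow>
     (\<exists>h. h \<in> S \<rightarrow> full_trans m \<and> inj_on h S \<and>
          (\<forall>x\<in>S. \<forall>y\<in>S. h (mult x y) = trans_mult m (h x) (h y)))"

text \<open>Intended for finite semigroups \<open>S\<close>, where such an \<open>m\<close> always exists
  (the right regular representation on \<open>S\<close> with an identity adjoined).\<close>

definition semigroup_degree :: "'a set \<Rightarrow> ('a \<Rightarrow> 'a \<Rightarrow> 'a) \<Rightarrow> nat" where
  "semigroup_degree S mult = (LEAST m. 1 \<le> m \<and> embeds_in_full_trans S mult m)"

definition variant_degree :: "nat \<Rightarrow> (nat \<Rightarrow> nat) \<Rightarrow> nat" where
  "variant_degree n a = semigroup_degree (full_trans n) (variant_mult n a)"

end

theory Submission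
  imports Defs
begin

text \<open>Let \<open>c\<close> be the unique value of \<open>a\<close>. In the variant, \<open>f \<star> g\<close> is the constant map with value
  \<open>g c\<close>, so it depends only on the class \<open>g c\<close> of \<open>g\<close>. There are \<open>n\<close> classes, each of size \<open>n\<^sup>n\<^sup>-\<^sup>1\<close>.
  For a faithful action on \<open>m\<close> points, let \<open>A\<close> be the union of the images of all elements. The
  constant maps act with a common kernel, whose blocks meet \<open>A\<close> in sets of sizes \<open>\<alpha>\<^sub>i\<close>; the action
  of \<open>f\<close> on \<open>A\<close> is a choice of one point of \<open>A\<close> in each block, determined by the class of \<open>f\<close>, and
  outside \<open>A\<close> it maps each point into the trace of its block on \<open>A\<close>. Counting, and moving all \<open>b\<close>
  points outside \<open>A\<close> to a block with the largest \<open>\<alpha>\<^sub>i\<close>, one sees that the degree is the least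
  \<open>(\<Sum>i. \<alpha>\<^sub>i) + b\<close> subject to \<open>n \<le> (\<Prod>i. \<alpha>\<^sub>i)\<close> and \<open>n\<^sup>n\<^sup>-\<^sup>1 \<le> (max \<alpha>)\<^sup>b\<close>.
  From a solution for \<open>n + 1\<close>, one for \<open>n\<close> of smaller cost arises by decreasing \<open>b\<close>
  if \<open>max \<alpha> \<le> 2n\<close>, and by decreasing the largest \<open>\<alpha>\<^sub>i\<close> otherwise.\<close>

text \<open>The index \<open>i0\<close> may be any block: a largest one gives the weakest power
  condition, so the admissible \<open>m\<close> are the same.\<close>

definition block_system :: "nat \<Rightarrow> nat \<Rightarrow> bool" where
  "block_system n m \<longleftrightarrow> (\<exists>(I::nat set) \<alpha> i0 b. finite I \<and> i0 \<in> I \<and> n \<le> prod \<alpha> I \<and>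
     n ^ (n - 1) \<le> \<alpha> i0 ^ b \<and> m = sum \<alpha> I + b)"

section \<open>Products and classes in a variant by a rank-one map\<close>

definition const_trans :: "nat \<Rightarrow> nat \<Rightarrow> nat \<Rightarrow> nat" where
  "const_trans n j = (\<lambda>x\<in>{1..n}. j)"

lemma const_trans_in [simp]: "j \<in> {1..n} \<Longrightarrow> const_trans n j \<in> full_trans n"
  by (auto simp: const_trans_def full_trans_def)

lemma const_trans_apply [simp]: "x \<in> {1..n} \<Longrightarrow> const_trans n j x = j"
  by (auto simp: const_trans_def)

lemma full_trans_apply: "f \<in> full_trans n \<Longrightarrow> x \<in> {1..n} \<Longrightarrow> f x \<in> {1..n}"
  by (auto simp: full_trans_def)

lemma rank_one_constant:
  assumes "a \<in> full_trans n" "trans_rank n a = 1"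
  obtains c where "c \<in> {1..n}" "\<And>x. x \<in> {1..n} \<Longrightarrow> a x = c"
proof -
  obtain c where c: "a ` {1..n} = {c}"
    using assms(2) by (auto simp: trans_rank_def card_1_singleton_iff)
  then obtain x where "x \<in> {1..n}" "a x = c" by blast
  then have "c \<in> {1..n}" using full_trans_apply[OF assms(1)] by blast
  moreover have "a x = c" if "x \<in> {1..n}" for x using c that by blast
  ultimately show thesis using that by blast
qed

lemma variant_mult_rank_one:
  assumes "\<And>x. x \<in> {1..n} \<Longrightarrow> a x = c" "f \<in> full_trans n"
  shows "variant_mult n a f g = const_trans n (g c)"
  using assms full_trans_apply[OF assms(2)]
  by (auto simp: variant_mult_def trans_mult_def compose_def const_trans_def fun_eq_iff)

lemma card_full_trans_fibre:
  assumes "c \<in> {1..n}" "j \<in> {1..n}"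
  shows "card {f \<in> full_trans n. f c = j} = n ^ (n - 1)"
proof -
  have "{f \<in> full_trans n. f c = j} = (\<Pi>\<^sub>E x\<in>{1..n}. if x = c then {j} else {1..n})"
  proof (intro equalityI subsetI)
    fix f assume "f \<in> (\<Pi>\<^sub>E x\<in>{1..n}. if x = c then {j} else {1..n})"
    then have f: "f x \<in> (if x = c then {j} else {1..n})" "f \<in> extensional {1..n}"
      if "x \<in> {1..n}" for x using that by (auto simp: PiE_iff simp del: atLeastAtMost_iff)
    then have "f c = j" "f x \<in> {1..n}" if "x \<in> {1..n}" for x
      using assms f(1)[OF that] f(1)[OF assms(1)] by (auto split: if_splits)
    then show "f \<in> {f \<in> full_trans n. f c = j}"
      using assms f(2) by (auto simp: full_trans_def PiE_iff simp del: atLeastAtMost_iff One_nat_def)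
  qed (use assms in \<open>auto simp: full_trans_def PiE_iff simp del: atLeastAtMost_iff One_nat_def\<close>)
  then have "card {f \<in> full_trans n. f c = j} = (\<Prod>x\<in>{1..n}. if x = c then 1 else n)"
    by (simp add: card_PiE if_distrib cong: if_cong)
  also have "\<dots> = (\<Prod>x\<in>{1..n} - {c}. n)"
    using assms by (subst prod.remove[of _ c]) auto
  finally show ?thesis using assms by simp
qed

lemma finite_full_trans: "finite (full_trans n)"
  by (simp add: full_trans_def finite_PiE)

section \<open>From a block system to an embedding\<close>

text \<open>Serves to number the elements of a class when the homomorphism law already dictates the
  action of the constant map in it.\<close>

lemma inj_with_prescribed_value:
  assumes "finite A" "finite B" "card A \<le> card B" "x \<in> A" "y \<in> B"
  shows "\<exists>f. inj_on f A \<and> f ` A \<subseteq> B \<and> f x = y"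
proof -
  have "card (A - {x}) \<le> card (B - {y})" using assms by simp
  then obtain g where g: "inj_on g (A - {x})" "g ` (A - {x}) \<subseteq> B - {y}"
    using assms card_le_inj[of "A - {x}" "B - {y}"] by auto
  have "inj_on (g(x := y)) A"
    using g by (auto simp: inj_on_def)
  moreover have "(g(x := y)) ` A \<subseteq> B" using g assms by auto
  ultimately show ?thesis by (intro exI[of _ "g(x := y)"]) auto
qed

text \<open>Conjugation by a bijection between \<open>{1..card X}\<close> and \<open>X\<close>; this
  allows a disjoint union as the set of points acted on.\<close>

lemma embeds_in_full_trans_card:
  assumes "finite X" and h: "h \<in> S \<rightarrow> (X \<rightarrow>\<^sub>E X)" and inj: "inj_on h S"
    and hom: "\<And>x y. x \<in> S \<Longrightarrow> y \<in> S \<Longrightarrow> h (mult x y) = compose X (h y) (h x)"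
  shows "embeds_in_full_trans S mult (card X)"
proof -
  define m where "m = card X"
  obtain \<gamma> where \<gamma>: "bij_betw \<gamma> {1..m} X"
    using ex_bij_betw_nat_finite_1[OF assms(1)] m_def by blast
  define \<beta> where "\<beta> = the_inv_into {1..m} \<gamma>"
  have \<gamma>X: "\<gamma> i \<in> X" if "i \<in> {1..m}" for i using \<gamma> that by (auto simp: bij_betw_def)
  have \<beta>m: "\<beta> p \<in> {1..m}" if "p \<in> X" for p
    using bij_betw_the_inv_into[OF \<gamma>] that unfolding \<beta>_def bij_betw_def by blast
  have \<gamma>\<beta>: "\<gamma> (\<beta> p) = p" if "p \<in> X" for p
    using f_the_inv_into_f_bij_betw[OF \<gamma>] that by (simp add: \<beta>_def)
  have hX: "h s p \<in> X" if "s \<in> S" "p \<in> X" for s p using h that by blast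
  define k where "k s = (\<lambda>i\<in>{1..m}. \<beta> (h s (\<gamma> i)))" for s
  have "k \<in> S \<rightarrow> full_trans m"
    unfolding full_trans_def k_def
    by (intro Pi_I restrict_PiE_iff[THEN iffD2] ballI \<beta>m hX \<gamma>X)
  moreover have "inj_on k S"
  proof (rule inj_onI)
    fix s t assume st: "s \<in> S" "t \<in> S" "k s = k t"
    have "h s p = h t p" if p: "p \<in> X" for p
    proof -
      have "k s (\<beta> p) = k t (\<beta> p)" using st by simp
      then have "\<beta> (h s p) = \<beta> (h t p)" using p by (simp add: k_def \<beta>m \<gamma>\<beta> del: atLeastAtMost_iff One_nat_def)
      then show ?thesis using \<gamma>\<beta> hX st p by metis
    qed
    then have "h s = h t" using h st by (intro PiE_ext[of _ X "\<lambda>_. X"]) blast+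
    then show "s = t" using inj st by (auto dest: inj_onD)
  qed
  moreover have "k (mult s t) = trans_mult m (k s) (k t)" if st: "s \<in> S" "t \<in> S" for s t
  proof
    fix i
    show "k (mult s t) i = trans_mult m (k s) (k t) i"
    proof (cases "i \<in> {1..m}")
      case True
      then show ?thesis using st hom[OF st]
        by (simp add: k_def trans_mult_def compose_def \<gamma>X \<beta>m hX \<gamma>\<beta> del: atLeastAtMost_iff One_nat_def)
    next
      case False
      then show ?thesis by (simp add: k_def trans_mult_def compose_def del: atLeastAtMost_iff One_nat_def)
    qed
  qed
  ultimately show ?thesis unfolding embeds_in_full_trans_def m_def[symmetric] by blast
qed

text \<open>The points are those of the blocks and \<open>b\<close> extra ones. Distinct choice
  functions \<open>\<sigma> j\<close> encode the classes; within class \<open>j\<close>, the map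
  \<open>\<tau> j\<close> separates elements by how they send the extra points into block
  \<open>i0\<close>.\<close>

lemma block_system_imp_embeds:
  assumes c: "c \<in> {1..n}" and a: "\<And>x. x \<in> {1..n} \<Longrightarrow> a x = c" and bs: "block_system n m"
  shows "embeds_in_full_trans (full_trans n) (variant_mult n a) m"
proof -
  from bs obtain I :: "nat set" and \<alpha> i0 b where I: "finite I" "i0 \<in> I"
    and n: "n \<le> prod \<alpha> I" and pw: "n ^ (n - 1) \<le> \<alpha> i0 ^ b" and m: "m = sum \<alpha> I + b"
    unfolding block_system_def by blast
  have "prod \<alpha> I \<noteq> 0" using n c by auto
  then have \<alpha>: "\<alpha> i > 0" if "i \<in> I" for i using I that by auto
  define P where "P = (\<Pi>\<^sub>E i\<in>I. {..<\<alpha> i})"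
  have "finite P" "card P = prod \<alpha> I" using I by (auto simp: P_def card_PiE finite_PiE)
  then obtain \<sigma> where \<sigma>: "inj_on \<sigma> {1..n}" "\<sigma> ` {1..n} \<subseteq> P"
    using card_le_inj[of "{1..n}" P] n by auto
  have \<sigma>I: "\<sigma> j i < \<alpha> i" if "j \<in> {1..n}" "i \<in> I" for i j
    using \<sigma>(2) that by (auto simp: P_def PiE_iff image_subset_iff)
  define Q where "Q = ({..<b} \<rightarrow>\<^sub>E {..<\<alpha> i0})"
  have Q: "finite Q" "card Q = \<alpha> i0 ^ b" by (auto simp: Q_def card_PiE finite_PiE)
  \<comment> \<open>The value at \<open>const_trans n j\<close> is forced: this map is the product
    of any \<open>f\<close> with a \<open>g\<close> of class \<open>j\<close>, and once
    \<open>h f\<close> has sent an extra point into block \<open>i0\<close>, \<open>h g\<close>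
    moves it to the point \<open>\<sigma> j i0\<close> of that block.\<close>
  have "\<forall>j\<in>{1..n}. \<exists>t. inj_on t {f \<in> full_trans n. f c = j} \<and>
    t ` {f \<in> full_trans n. f c = j} \<subseteq> Q \<and> t (const_trans n j) = (\<lambda>x\<in>{..<b}. \<sigma> j i0)"
  proof (intro ballI inj_with_prescribed_value)
    fix j assume j: "j \<in> {1..n}"
    show "finite {f \<in> full_trans n. f c = j}" using finite_full_trans by simp
    show "card {f \<in> full_trans n. f c = j} \<le> card Q"
      using card_full_trans_fibre[OF c j] Q pw by simp
    show "const_trans n j \<in> {f \<in> full_trans n. f c = j}" using c j by simp
    show "(\<lambda>x\<in>{..<b}. \<sigma> j i0) \<in> Q" using \<sigma>I[OF j I(2)] by (auto simp: Q_def)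
  qed (rule Q)
  from bchoice[OF this] obtain \<tau> where \<tau>: "\<And>j. j \<in> {1..n} \<Longrightarrow> inj_on (\<tau> j) {f \<in> full_trans n. f c = j}"
    "\<And>j. j \<in> {1..n} \<Longrightarrow> \<tau> j ` {f \<in> full_trans n. f c = j} \<subseteq> Q"
    "\<And>j. j \<in> {1..n} \<Longrightarrow> \<tau> j (const_trans n j) = (\<lambda>x\<in>{..<b}. \<sigma> j i0)"
    by blast
  have fc: "f c \<in> {1..n}" if "f \<in> full_trans n" for f using full_trans_apply[OF that c] .
  have \<tau>Q: "\<tau> (f c) f \<in> Q" if "f \<in> full_trans n" for f
    using \<tau>(2)[OF fc[OF that]] that by blast
  then have \<tau>I: "\<tau> (f c) f x < \<alpha> i0" if "f \<in> full_trans n" "x < b" for f x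
    using that by (auto simp: Q_def PiE_iff)
  define X where "X = Sigma I (\<lambda>i. {..<\<alpha> i}) <+> {..<b}"
  define h :: "(nat \<Rightarrow> nat) \<Rightarrow> nat \<times> nat + nat \<Rightarrow> nat \<times> nat + nat"
    where "h f = (\<lambda>p\<in>X. case p of Inl q \<Rightarrow> Inl (fst q, \<sigma> (f c) (fst q))
    | Inr x \<Rightarrow> Inl (i0, \<tau> (f c) f x))" for f
  have hl: "h f (Inl (i, t)) = Inl (i, \<sigma> (f c) i)" if "i \<in> I" "t < \<alpha> i" for f i t
    using that by (auto simp: h_def X_def)
  have hr: "h f (Inr x) = Inl (i0, \<tau> (f c) f x)" if "x < b" for f x
    using that by (auto simp: h_def X_def)
  have "finite X" using I by (auto simp: X_def)
  have "card X = m" using I by (auto simp: X_def card_Plus m)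
  moreover have "embeds_in_full_trans (full_trans n) (variant_mult n a) (card X)"
  proof (rule embeds_in_full_trans_card[OF \<open>finite X\<close>])
    show "h \<in> full_trans n \<rightarrow> (X \<rightarrow>\<^sub>E X)"
    proof
      fix f assume f: "f \<in> full_trans n"
      have "h f p \<in> X" if "p \<in> X" for p
        using that I \<sigma>I[OF fc[OF f]] \<tau>I[OF f] by (auto simp: X_def h_def)
      then show "h f \<in> X \<rightarrow>\<^sub>E X" by (auto simp: h_def)
    qed
    show "inj_on h (full_trans n)"
    proof (rule inj_onI)
      fix f g assume fg: "f \<in> full_trans n" "g \<in> full_trans n" "h f = h g"
      \<comment> \<open>The action is constant on each block, so the point 0, present because
        \<open>\<alpha> i\<close> is positive, reveals the value of the choice function.\<close>
      have "\<sigma> (f c) i = \<sigma> (g c) i" if "i \<in> I" for i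
        using fun_cong[OF fg(3), of "Inl (i, 0)"] hl[OF that \<alpha>[OF that]] by simp
      moreover have "\<sigma> (f c) \<in> P" "\<sigma> (g c) \<in> P" using \<sigma>(2) fc fg by blast+
      ultimately have "\<sigma> (f c) = \<sigma> (g c)" unfolding P_def by (metis PiE_ext)
      then have eq: "f c = g c" using \<sigma>(1) fc fg by (auto dest: inj_onD)
      have "\<tau> (f c) f x = \<tau> (g c) g x" if "x \<in> {..<b}" for x
        using fun_cong[OF fg(3), of "Inr x"] hr that by simp
      then have "\<tau> (f c) f = \<tau> (g c) g" using \<tau>Q fg unfolding Q_def by (metis PiE_ext)
      then show "f = g"
        using \<tau>(1)[OF fc[OF fg(1)]] fg eq by (auto dest: inj_onD)
    qed
    fix f g assume fg: "f \<in> full_trans n" "g \<in> full_trans n"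
    have "h (const_trans n (g c)) p = h g (h f p)" if "p \<in> X" for p
    proof (cases p)
      case (Inl q)
      then obtain i t where "p = Inl (i, t)" "i \<in> I" "t < \<alpha> i" using \<open>p \<in> X\<close> by (auto simp: X_def)
      then show ?thesis using \<sigma>I[OF fc[OF fg(1)]] c by (simp add: hl)
    next
      case (Inr x)
      then have "p = Inr x" "x < b" using \<open>p \<in> X\<close> by (auto simp: X_def)
      then show ?thesis using I \<tau>I[OF fg(1)] c \<tau>(3)[OF fc[OF fg(2)]] by (simp add: hl hr)
    qed
    then have "h (const_trans n (g c)) = compose X (h g) (h f)"
      by (auto simp: compose_def fun_eq_iff) (simp add: h_def)
    then show "h (variant_mult n a f g) = compose X (h g) (h f)"
      using variant_mult_rank_one[where a = a and c = c] a fg(1) by simp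
  qed
  ultimately show ?thesis by simp
qed

section \<open>From an embedding to a block system\<close>

lemma embeds_imp_block_system:
  assumes c: "c \<in> {1..n}" and a: "\<And>x. x \<in> {1..n} \<Longrightarrow> a x = c" and "1 \<le> m"
    and emb: "embeds_in_full_trans (full_trans n) (variant_mult n a) m"
  shows "block_system n m"
proof -
  define S where "S = full_trans n"
  define X where "X = {1..m}"
  obtain h where h: "h \<in> S \<rightarrow> full_trans m" "inj_on h S"
    and hom: "\<And>f g. f \<in> S \<Longrightarrow> g \<in> S \<Longrightarrow> h (variant_mult n a f g) = trans_mult m (h f) (h g)"
    using emb unfolding embeds_in_full_trans_def S_def by blast
  have hX: "h f x \<in> X" if "f \<in> S" "x \<in> X" for f x
    using h(1) that full_trans_apply unfolding X_def by blast
  have hext: "h f = h g" if "f \<in> S" "g \<in> S" "\<And>x. x \<in> X \<Longrightarrow> h f x = h g x" for f g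
    using h(1) that unfolding X_def full_trans_def by (intro PiE_ext[of _ "{1..m}" "\<lambda>_. {1..m}"]) blast+
  define E where "E j = h (const_trans n j)" for j
  have cS: "const_trans n j \<in> S" if "j \<in> {1..n}" for j using that by (simp add: S_def)
  have fc: "f c \<in> {1..n}" if "f \<in> S" for f using full_trans_apply c that unfolding S_def by blast
  have mul: "h g (h f x) = E (g c) x" if "f \<in> S" "g \<in> S" "x \<in> X" for f g x
    using fun_cong[OF hom[OF that(1,2)], of x] that
      variant_mult_rank_one[where a = a and c = c, OF a, of n f g]
    by (simp add: S_def X_def E_def trans_mult_def compose_def)
  have n1: "1 \<in> {1..n}" using c by auto
  \<comment> \<open>The value 1 is an arbitrary choice: by \<open>kh\<close> and \<open>Ek\<close>
    below, every \<open>E j\<close> has the same kernel as \<open>k\<close>. Since \<open>k\<close>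
    is idempotent, its image \<open>I\<close> meets each kernel class in one point and so indexes
    the blocks.\<close>
  define k where "k = E 1"
  define A where "A = (\<Union>f\<in>S. h f ` X)"
  have AX: "A \<subseteq> X" using hX by (auto simp: A_def)
  have hA: "h f x \<in> A" if "f \<in> S" "x \<in> X" for f x using that by (auto simp: A_def)
  have EX: "E j x \<in> X" if "j \<in> {1..n}" "x \<in> X" for j x using hX cS that by (simp add: E_def)
  have kX: "k x \<in> X" if "x \<in> X" for x using EX n1 that by (simp add: k_def del: One_nat_def)
  have kh: "k (h f x) = k x" if "f \<in> S" "x \<in> X" for f x
    using mul[OF that(1) cS[OF n1] that(2)] c n1 by (simp add: k_def E_def)
  have Ek: "E j (k x) = E j x" if "j \<in> {1..n}" "x \<in> X" for j x
    using mul[OF cS[OF n1] cS[OF that(1)] that(2)] c by (simp add: k_def E_def)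
  \<comment> \<open>A point of \<open>A\<close> is already some \<open>h f x\<close>, so
    \<open>h g\<close> acts on it as a product does, through the class of \<open>g\<close>
    only.\<close>
  have onA: "h g y = E (g c) (k y)" if gy: "g \<in> S" "y \<in> A" for g y
  proof -
    obtain f x where "f \<in> S" "x \<in> X" "y = h f x" using gy(2) unfolding A_def by blast
    then show ?thesis using mul[of f g x] gy(1) kh[of f x] Ek[of "g c" x] fc[of g] by metis
  qed
  define I where "I = k ` X"
  define B where "B i = {y \<in> A. k y = i}" for i
  have fin: "finite X" "finite A" "finite I" "\<And>i. finite (B i)"
    using AX by (auto simp: X_def I_def B_def intro: finite_subset)
  have IX: "I \<subseteq> X" using kX by (auto simp: I_def)
  have kk: "k (k x) = k x" if "x \<in> X" for x using Ek[OF n1 that] by (simp add: k_def)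
  have "n \<le> card (\<Pi>\<^sub>E i\<in>I. B i)"
  proof -
    \<comment> \<open>By \<open>Ek\<close>, the values on the transversal \<open>I\<close> determine
      \<open>E j\<close>.\<close>
    have "inj_on (\<lambda>j. restrict (E j) I) {1..n}"
    proof (rule inj_onI)
      fix i j assume ij: "i \<in> {1..n}" "j \<in> {1..n}" "restrict (E i) I = restrict (E j) I"
      have "E i x = E j x" if "x \<in> X" for x
      proof -
        have "E i (k x) = E j (k x)" using fun_cong[OF ij(3), of "k x"] that by (simp add: I_def)
        then show ?thesis using Ek ij that by simp
      qed
      then have "const_trans n i = const_trans n j"
        using hext[OF cS cS] h(2) cS ij unfolding E_def by (metis inj_onD)
      then show "i = j" using const_trans_apply[OF c] by metis
    qed
    moreover have "(\<lambda>j. restrict (E j) I) ` {1..n} \<subseteq> (\<Pi>\<^sub>E i\<in>I. B i)"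
      using hA[OF cS] kh[OF cS] IX kk by (auto simp: B_def E_def I_def kX)
    ultimately have "card {1..n} \<le> card (\<Pi>\<^sub>E i\<in>I. B i)"
      using fin by (intro card_inj_on_le finite_PiE) auto
    then show ?thesis by simp
  qed
  then have n: "n \<le> (\<Prod>i\<in>I. card (B i))" using fin by (simp add: card_PiE)
  \<comment> \<open>Elements of one class agree on \<open>A\<close> by \<open>onA\<close>, so their
    actions on \<open>X - A\<close> must differ; by \<open>kh\<close>, a point \<open>x\<close>
    there can only go to \<open>B (k x)\<close>.\<close>
  define F where "F = {f \<in> S. f c = 1}"
  have "card F \<le> card (\<Pi>\<^sub>E x\<in>X - A. B (k x))"
  proof (rule card_inj_on_le)
    show "inj_on (\<lambda>f. restrict (h f) (X - A)) F"
    proof (rule inj_onI)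
      fix f g assume fg: "f \<in> F" "g \<in> F" "restrict (h f) (X - A) = restrict (h g) (X - A)"
      have "h f x = h g x" if "x \<in> X" for x
      proof (cases "x \<in> A")
        case True then show ?thesis using onA fg by (simp add: F_def)
      next
        case False then show ?thesis using fun_cong[OF fg(3), of x] that by simp
      qed
      then show "f = g" using hext h(2) fg unfolding F_def inj_on_def by blast
    qed
    show "(\<lambda>f. restrict (h f) (X - A)) ` F \<subseteq> (\<Pi>\<^sub>E x\<in>X - A. B (k x))"
      using hA kh unfolding F_def B_def
      by (intro image_subsetI restrict_PiE_iff[THEN iffD2] ballI) blast
    show "finite (\<Pi>\<^sub>E x\<in>X - A. B (k x))" using fin by (intro finite_PiE) auto
  qed
  then have F: "n ^ (n - 1) \<le> (\<Prod>x\<in>X - A. card (B (k x)))"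
    using fin card_full_trans_fibre[OF c n1] by (simp add: F_def S_def card_PiE)
  have "X \<noteq> {}" using \<open>1 \<le> m\<close> by (simp add: X_def)
  then have "I \<noteq> {}" by (simp add: I_def)
  have "Max ((card \<circ> B) ` I) \<in> (card \<circ> B) ` I" using fin \<open>I \<noteq> {}\<close> by simp
  then obtain i0 where i0: "i0 \<in> I" "card (B i0) = Max ((card \<circ> B) ` I)" by auto
  then have max: "card (B i) \<le> card (B i0)" if "i \<in> I" for i using fin that by simp
  \<comment> \<open>Reattaching every outside point to a largest block can only increase the
    count.\<close>
  have "(\<Prod>x\<in>X - A. card (B (k x))) \<le> (\<Prod>x\<in>X - A. card (B i0))"
    by (intro prod_mono) (auto simp: I_def intro!: max)
  also have "\<dots> = card (B i0) ^ card (X - A)" by simp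
  finally have "n ^ (n - 1) \<le> card (B i0) ^ card (X - A)" using F by simp
  moreover have "m = (\<Sum>i\<in>I. card (B i)) + card (X - A)"
  proof -
    have "A = (\<Union>i\<in>I. B i)" using AX by (auto simp: B_def I_def)
    then have "card A = (\<Sum>i\<in>I. card (B i))"
      using fin by (simp only:) (intro card_UN_disjoint, auto simp: B_def)
    moreover have "card X = card A + card (X - A)"
      using fin AX by (simp add: card_Diff_subset card_mono)
    ultimately show ?thesis by (simp add: X_def)
  qed
  ultimately show ?thesis unfolding block_system_def
    using fin i0 n by (intro exI[of _ I] exI[of _ "\<lambda>i. card (B i)"] exI[of _ i0] exI) auto
qed

section \<open>Power inequalities for the descent\<close>

text \<open>The first two terms of the binomial expansion of \<open>(n + 1) ^ n\<close> both equal
  \<open>n ^ n\<close>.\<close>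

lemma two_mult_power_le: "2 * n ^ n \<le> (n + 1) ^ n" if "1 \<le> n" for n :: nat
proof -
  obtain k where k: "n = Suc k" using \<open>1 \<le> n\<close> not0_implies_Suc[of n] by fastforce
  \<comment> \<open>The exponent is decoupled from the base, which stays fixed during the
    induction.\<close>
  have "n ^ Suc k + (k + 1) * n ^ k \<le> (n + 1) ^ Suc k" for k
  proof (induction k)
    case (Suc k)
    have "n ^ Suc (Suc k) + (Suc k + 1) * n ^ Suc k \<le> (n + 1) * (n ^ Suc k + (k + 1) * n ^ k)"
      by (simp add: algebra_simps)
    also have "\<dots> \<le> (n + 1) * (n + 1) ^ Suc k" using Suc by (intro mult_left_mono) auto
    finally show ?case by simp
  qed simp
  from this[of k] show ?thesis using k by simp
qed

text \<open>The difference of the two powers factors into a sum of \<open>b\<close> products, each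
  at most \<open>a ^ (b - 1)\<close>.\<close>

lemma Bernoulli_pred_nat: "a ^ b \<le> (a - 1) ^ b + b * a ^ (b - 1)" for a b :: nat
proof (cases a)
  case (Suc d)
  show ?thesis
  proof (induction b)
    case (Suc b)
    show ?case
    proof (cases b)
      case 0 then show ?thesis by simp
    next
      case (Suc e)
      have "a ^ Suc b = d * a ^ b + a ^ b" using \<open>a = Suc d\<close> by simp
      also have "d * a ^ b \<le> d * (d ^ b + b * a ^ (b - 1))"
        using Suc.IH \<open>a = Suc d\<close> by (intro mult_left_mono) auto
      also have "\<dots> \<le> d ^ Suc b + b * a ^ b"
        using Suc \<open>a = Suc d\<close> by (simp add: algebra_simps)
      finally show ?thesis using \<open>a = Suc d\<close> by (simp add: algebra_simps)
    qed
  qed simp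
qed (cases b, auto)

text \<open>If \<open>b\<close> is at least \<open>n - 1\<close>, any base from \<open>n\<close> on
  suffices. Otherwise \<open>b\<close> is small against \<open>a\<close>, and lowering the base
  loses at most half of the power, which \<open>two_mult_power_le\<close> can afford.\<close>

lemma power_pred_base_bound:
  fixes a b n :: nat
  assumes "1 \<le> n" "2 * n < a" "(n + 1) ^ n \<le> a ^ b"
  shows "n ^ (n - 1) \<le> (a - 1) ^ b"
proof (cases "n - 1 \<le> b")
  case True
  have "n ^ (n - 1) \<le> n ^ b" using assms True by (intro power_increasing) auto
  also have "\<dots> \<le> (a - 1) ^ b" using assms by (intro power_mono) auto
  finally show ?thesis .
next
  case False
  have "2 * (b * a ^ (b - 1)) \<le> a ^ b"
  proof (cases b)
    case (Suc e)
    have "2 * b * a ^ e \<le> a * a ^ e" using False assms by (intro mult_right_mono) auto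
    then show ?thesis using Suc by (simp add: algebra_simps)
  qed simp
  then have "a ^ b \<le> 2 * (a - 1) ^ b" using Bernoulli_pred_nat[of a b] by linarith
  then have "n ^ n \<le> (a - 1) ^ b" using two_mult_power_le[OF assms(1)] assms(3) by linarith
  moreover have "n ^ (n - 1) \<le> n ^ n" using assms by (intro power_increasing) auto
  ultimately show ?thesis by linarith
qed

text \<open>Lowering the exponent divides by at most \<open>2 * n\<close>, while
  \<open>(n + 1) ^ n\<close> is at least \<open>2 * n\<close> times
  \<open>n ^ (n - 1)\<close>.\<close>

lemma power_pred_exponent_bound:
  fixes a b n :: nat
  assumes "1 \<le> n" "0 < a" "a \<le> 2 * n" "(n + 1) ^ n \<le> a ^ Suc b"
  shows "n ^ (n - 1) \<le> a ^ b"
proof -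
  have "a * n ^ (n - 1) \<le> 2 * n * n ^ (n - 1)" using assms by (intro mult_right_mono) auto
  also have "\<dots> = 2 * n ^ n" using assms(1) by (cases n) auto
  also have "\<dots> \<le> a * a ^ b" using two_mult_power_le[OF assms(1)] assms(4) by simp
  finally show ?thesis using assms(2) by simp
qed

section \<open>Descent and comparison of degrees\<close>

text \<open>Block \<open>i0\<close> stands in for a largest one. The bound \<open>1 \<le> m'\<close>
  makes \<open>m'\<close> a candidate in the \<open>LEAST\<close> that defines the degree.\<close>

lemma block_system_pred:
  assumes "1 \<le> n" "block_system (Suc n) m"
  obtains m' where "m = Suc m'" "1 \<le> m'" "block_system n m'"
proof -
  from assms(2) obtain I :: "nat set" and \<alpha> i0 b where I: "finite I" "i0 \<in> I"
    and n: "Suc n \<le> prod \<alpha> I" and pw: "(n + 1) ^ n \<le> \<alpha> i0 ^ b" and m: "m = sum \<alpha> I + b"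
    unfolding block_system_def by auto
  have "prod \<alpha> I \<noteq> 0" using n by auto
  then have pos: "0 < \<alpha> i" if "i \<in> I" for i using I that by auto
  have split: "sum \<alpha> I = \<alpha> i0 + sum \<alpha> (I - {i0})" using I by (simp add: sum.remove)
  have "2 * n ^ n \<le> \<alpha> i0 ^ b" using two_mult_power_le[OF assms(1)] pw by linarith
  moreover have "1 \<le> n ^ n" using assms(1) by simp
  \<comment> \<open>Exponent 0 would give \<open>2 \<le> 1\<close>; hence there is an extra point to
    remove.\<close>
  ultimately have "b \<noteq> 0" by (cases b) auto
  then obtain b' where b: "b = Suc b'" by (cases b) auto
  show thesis
  proof (cases "\<alpha> i0 \<le> 2 * n")
    case True
    then have "n ^ (n - 1) \<le> \<alpha> i0 ^ b'"
      using power_pred_exponent_bound assms(1) pos[OF I(2)] pw b by blast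
    then have "block_system n (sum \<alpha> I + b')"
      unfolding block_system_def using I n by (intro exI[of _ I] exI[of _ \<alpha>] exI[of _ i0] exI[of _ b']) auto
    then show thesis using that[of "sum \<alpha> I + b'"] m b split pos[OF I(2)] by simp
  next
    case False
    define \<alpha>' where "\<alpha>' = \<alpha>(i0 := \<alpha> i0 - 1)"
    have *: "prod \<alpha>' (I - {i0}) = prod \<alpha> (I - {i0})" "sum \<alpha>' (I - {i0}) = sum \<alpha> (I - {i0})"
      by (auto simp: \<alpha>'_def intro!: prod.cong sum.cong)
    have "prod \<alpha> (I - {i0}) \<ge> 1" using pos I by (intro prod_ge_1) (auto simp: Suc_le_eq)
    then have "n * 1 \<le> (\<alpha> i0 - 1) * prod \<alpha> (I - {i0})" using False by (intro mult_mono) auto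
    then have "n \<le> prod \<alpha>' I" using I * by (simp add: prod.remove[of I i0] \<alpha>'_def)
    moreover have "n ^ (n - 1) \<le> \<alpha>' i0 ^ b"
      using power_pred_base_bound[of n "\<alpha> i0" b] False assms(1) pw by (simp add: \<alpha>'_def)
    ultimately have "block_system n (sum \<alpha>' I + b)"
      unfolding block_system_def using I by (intro exI[of _ I] exI[of _ \<alpha>'] exI[of _ i0] exI[of _ b]) auto
    moreover have "sum \<alpha>' I = \<alpha> i0 - 1 + sum \<alpha> (I - {i0})"
      using I * by (simp add: sum.remove[of I i0] \<alpha>'_def)
    ultimately show thesis using that[of "sum \<alpha>' I + b"] m b split False by simp
  qed
qed

text \<open>A single block of size \<open>n\<close> with \<open>n - 1\<close> extra points; this
  guarantees that the minimum is attained.\<close>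

lemma block_system_exists: "block_system n (n + (n - 1))"
  unfolding block_system_def
  by (intro exI[of _ "{0}"] exI[of _ "\<lambda>_. n"] exI[of _ 0] exI[of _ "n - 1"]) auto

text \<open>The right-hand side is free of \<open>a\<close>, so degrees for different
  \<open>n\<close> can be compared although the chosen maps are unrelated.\<close>

lemma variant_degree_rank_one:
  assumes "a \<in> full_trans n" "trans_rank n a = 1"
  shows "variant_degree n a = (LEAST m. 1 \<le> m \<and> block_system n m)"
proof -
  obtain c where c: "c \<in> {1..n}" "\<And>x. x \<in> {1..n} \<Longrightarrow> a x = c"
    using rank_one_constant[OF assms] by metis
  have "1 \<le> m \<and> embeds_in_full_trans (full_trans n) (variant_mult n a) m \<longleftrightarrow>
    1 \<le> m \<and> block_system n m" for m
    using block_system_imp_embeds[where a = a, OF c] embeds_imp_block_system[where a = a, OF c] by blast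
  then show ?thesis by (simp add: variant_degree_def semigroup_degree_def)
qed

theorem theorem5p24:
  fixes a :: "nat \<Rightarrow> nat \<Rightarrow> nat" and \<mu> :: "nat \<Rightarrow> nat"
  assumes "\<And>n. n \<ge> 1 \<Longrightarrow> a n \<in> full_trans n \<and> trans_rank n (a n) = 1"
    and "\<And>n. n \<ge> 1 \<Longrightarrow> \<mu> n = variant_degree n (a n)"
  shows "strict_mono_on {1..} \<mu>"
proof -
  have \<mu>: "\<mu> n = (LEAST m. 1 \<le> m \<and> block_system n m)" if "1 \<le> n" for n
    using assms that variant_degree_rank_one by simp
  have step: "\<mu> n < \<mu> (Suc n)" if n: "1 \<le> n" for n
  proof -
    have "1 \<le> \<mu> (Suc n) \<and> block_system (Suc n) (\<mu> (Suc n))"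
      using LeastI[of "\<lambda>m. 1 \<le> m \<and> block_system (Suc n) m" "Suc n + (Suc n - 1)"]
        block_system_exists[of "Suc n"] \<mu>[of "Suc n"] by simp
    then obtain m' where "\<mu> (Suc n) = Suc m'" "1 \<le> m'" "block_system n m'"
      using block_system_pred[OF n] by metis
    moreover from this have "\<mu> n \<le> m'" unfolding \<mu>[OF n] by (intro Least_le) auto
    ultimately show ?thesis by simp
  qed
  \<comment> \<open>The shift avoids \<open>\<mu> 0\<close>, about which nothing is assumed.\<close>
  have "strict_mono (\<lambda>n. \<mu> (Suc n))" using step by (simp add: strict_mono_Suc_iff)
  then have less: "\<mu> (Suc i) < \<mu> (Suc j)" if "i < j" for i j using that by (simp add: strict_mono_def)
  show ?thesis
  proof (rule strict_mono_onI)
    fix r s :: nat assume "r \<in> {1..}" "s \<in> {1..}" "r < s"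
    then show "\<mu> r < \<mu> s" using less[of "r - 1" "s - 1"] by simp
  qed
qed

end
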